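(* For the ruleset top entails, with $\boldsymbol{n}$ the heap of size $n$, $S_{\boldsymbol n}$ its set of immediate nimbers, $P_{\boldsymbol n}$ its set of protected nimbers and $\mathcal{N}$ the set of all nimbers: $P_{\boldsymbol 0}=S_{\boldsymbol 0}=\varnothing$, and for all $n>0$, $P_{\boldsymbol{n}}=\mathcal{N}\setminus(S_{\boldsymbol{n-1}}\cup P_{\boldsymbol{n-1}})$ and $S_{\boldsymbol n}=\{\mathcal G(\boldsymbol{\ell}+\boldsymbol m): \ell+m=n,\ \ell,m>0,\ \boldsymbol{\ell},\boldsymbol m\ne\{\infty\,|\,\overline{\infty}\}\}$.
   Context: Top entails is played on heaps of tokens: a player either removes the top token from one heap, or splits a heap into two nonempty heaps; after a top-token removal, the next move must be played on the same heap. In affine normal play (terminating games $\infty$ for Left win and $\overline{\infty}$ for Right win, absorbing under sum), the heap $\boldsymbol n$ has as Left options the splits $\boldsymbol\ell+\boldsymbol m$ ($\ell+m=n$, $\ell,m>0$) and the entailing option $\{\infty\,|\,(\boldsymbol{n-1})^{\mathcal R}\}$, symmetrically for Right. For an affine impartial game $G$, $S_G$ is the set of its Left options equal to nimbers, and $P_G$ (protected nimbers) is all nimbers if $\infty$ is a Left option, otherwise the set of $*n$ for which some Left-check option $G^{L}$ (one having $\infty$ as a Left option) satisfies $G^{L}+*n\in\mathscr{L}$. $\mathcal G$ is the Sprague–Grundy value; the moon $\{\infty\,|\,\overline{\infty}\}$ (value $\infty$) is the only non-nimber value modulo affine impartial equality, and $\boldsymbol n$ has value $\mathrm{mex}(\mathcal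 G(S_{\boldsymbol n}\cup P_{\boldsymbol n}))$, being the moon when $S_{\boldsymbol n}\cup P_{\boldsymbol n}$ is all nimbers. *)

theory Defs
  imports "HOL-Library.FSet" "HOL-Library.Extended_Nat"
begin

section \<open>Affine normal play\<close>

text \<open>Short game forms over the two terminating games: \<open>LInf\<close> is won by Left and \<open>RInf\<close>
  by Right, whoever is to move.  A form without options for the player to move is lost for
  that player (normal play), so zero is \<open>Game {||} {||}\<close>.\<close>

datatype game = LInf | RInf | Game "game fset" "game fset"

fun left_opts :: "game \<Rightarrow> game fset" where
  "left_opts (Game L R) = L"
| "left_opts _ = {||}"

fun right_opts :: "game \<Rightarrow> game fset" where
  "right_opts (Game L R) = R"
| "right_opts _ = {||}"

lemma size_option:
  assumes "g |\<in>| A"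
  shows "size g < Suc ((\<Sum>x\<in>fset A. Suc (size x)) + n)"
    and "size g < Suc (n + (\<Sum>x\<in>fset A. Suc (size x)))"
  using member_le_sum[OF assms, of "\<lambda>x. Suc (size x)"] by auto

instantiation game :: "{zero, plus, uminus}"
begin

definition zero_game :: game where
  "0 = Game {||} {||}"

text \<open>The sum of the two terminating games is left undefined in the theory.  The commutative
  convention \<open>LInf + RInf = LInf\<close> below only makes addition total: this sum never arises in
  playing a sum of games that are not terminating.\<close>

function plus_game :: "game \<Rightarrow> game \<Rightarrow> game" where
  "plus_game LInf H = LInf"
| "plus_game RInf LInf = LInf"
| "plus_game RInf RInf = RInf"
| "plus_game RInf (Game L R) = RInf"
| "plus_game (Game L R) LInf = LInf"
| "plus_game (Game L R) RInf = RInf"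
| "plus_game (Game GL GR) (Game HL HR) =
     Game ((\<lambda>g. plus_game g (Game HL HR)) |`| GL |\<union>| (\<lambda>h. plus_game (Game GL GR) h) |`| HL)
          ((\<lambda>g. plus_game g (Game HL HR)) |`| GR |\<union>| (\<lambda>h. plus_game (Game GL GR) h) |`| HR)"
  by pat_completeness auto
termination
  by (relation "measure (\<lambda>(G, H). size G + size H)") (auto simp: size_option)

primrec uminus_game :: "game \<Rightarrow> game" where
  "uminus_game LInf = RInf"
| "uminus_game RInf = LInf"
| "uminus_game (Game L R) = Game (uminus_game |`| R) (uminus_game |`| L)"

instance ..

end

function left_wins_first :: "game \<Rightarrow> bool" and left_wins_second :: "game \<Rightarrow> bool" where
  "left_wins_first LInf = True"
| "left_wins_first RInf = False"
| "left_wins_first (Game L R) = (\<exists>g\<in>fset L. left_wins_second g)"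
| "left_wins_second LInf = True"
| "left_wins_second RInf = False"
| "left_wins_second (Game L R) = (\<forall>g\<in>fset R. left_wins_first g)"
  by pat_completeness auto
termination
  by (relation "measure (case_sum size size)") (auto simp: size_option)

text \<open>Left wins, Next player wins, Previous player wins, Right wins.\<close>

datatype outcome = Out_L | Out_N | Out_P | Out_R

definition outcome :: "game \<Rightarrow> outcome" where
  "outcome G =
     (if left_wins_first G
      then (if left_wins_second G then Out_L else Out_N)
      else (if left_wins_second G then Out_P else Out_R))"

definition left_check :: "game \<Rightarrow> bool" where
  "left_check G \<longleftrightarrow> LInf |\<in>| left_opts G"

definition right_check :: "game \<Rightarrow> bool" where
  "right_check G \<longleftrightarrow> RInf |\<in>| right_opts G"

definition quiet :: "game \<Rightarrow> bool" where
  "quiet G \<longleftrightarrow> G \<noteq> LInf \<and> G \<noteq> RInf \<and> \<not> left_check G \<and> \<not> right_check G"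

inductive follower :: "game \<Rightarrow> game \<Rightarrow> bool" for G where
  refl: "follower G G"
| left: "follower G H \<Longrightarrow> K |\<in>| left_opts H \<Longrightarrow> follower G K"
| right: "follower G H \<Longrightarrow> K |\<in>| right_opts H \<Longrightarrow> follower G K"


section \<open>Affine impartial games\<close>

definition symmetric :: "game \<Rightarrow> bool" where
  "symmetric G \<longleftrightarrow> (\<exists>L. G = Game L (uminus |`| L))"

text \<open>Followers that are checks, such as the position right after an entailing move, need not
  be symmetric.\<close>

definition affine_impartial :: "game \<Rightarrow> bool" where
  "affine_impartial G \<longleftrightarrow> symmetric G \<and> (\<forall>H. follower G H \<and> quiet H \<longrightarrow> symmetric H)"

text \<open>Equality modulo affine impartial games.\<close>

definition eq_im :: "game \<Rightarrow> game \<Rightarrow> bool"  (infix "\<approx>" 50) where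
  "G \<approx> H \<longleftrightarrow> (\<forall>X. affine_impartial X \<longrightarrow> outcome (G + X) = outcome (H + X))"

fun nimber :: "nat \<Rightarrow> game" where
  "nimber n = Game (fset_of_list (map nimber [0..<n])) (fset_of_list (map nimber [0..<n]))"

declare nimber.simps [simp del]

definition nimbers :: "game set" where
  "nimbers = range nimber"

definition moon :: game where
  "moon = Game {|LInf|} {|RInf|}"

fun value_game :: "enat \<Rightarrow> game" where
  "value_game (enat n) = nimber n"
| "value_game \<infinity> = moon"

definition grundy :: "game \<Rightarrow> enat" where
  "grundy G = (THE v. G \<approx> value_game v)"

text \<open>Immediate nimbers are recorded by their canonical forms, so that they live in the same
  set \<^const>\<open>nimbers\<close> as the protected ones.\<close>

definition immediate_nimbers :: "game \<Rightarrow> game set" where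
  "immediate_nimbers G = {nimber n | n. \<exists>GL. GL |\<in>| left_opts G \<and> GL \<approx> nimber n}"

definition protected_nimbers :: "game \<Rightarrow> game set" where
  "protected_nimbers G =
     (if LInf |\<in>| left_opts G then nimbers
      else {nimber n | n. \<exists>GL. GL |\<in>| left_opts G \<and> left_check GL \<and>
                               outcome (GL + nimber n) = Out_L})"


section \<open>Top entails\<close>

text \<open>The splits of the heap of size \<open>n + 1\<close> are \<open>heap l + heap (n + 1 - l)\<close> for \<open>1 \<le> l \<le> n\<close>.
  Removing its top token leaves the heap of size \<open>n\<close>, in which the opponent has to answer.\<close>

fun heap :: "nat \<Rightarrow> game" where
  "heap 0 = 0"
| "heap (Suc n) =
     Game (finsert (Game {|LInf|} (right_opts (heap n)))
             (fset_of_list (map (\<lambda>l. heap l + heap (Suc n - l)) [1..<Suc n])))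
          (finsert (Game (left_opts (heap n)) {|RInf|})
             (fset_of_list (map (\<lambda>l. heap l + heap (Suc n - l)) [1..<Suc n])))"

end

theory Submission
  imports Defs
begin

text \<open>If the second player wins \<open>Y\<close>, then adding \<open>Y\<close> changes no outcome, because every move in
  \<open>Y\<close> can be answered there.  Hence \<open>G \<approx> *k\<close> if and only if \<open>G + *k\<close> is won by the
  previous player.  An affine impartial \<open>G\<close> for which there is no such \<open>k\<close> equals the moon:
  against a quiet \<open>X\<close> with the same property, Left plays in \<open>G\<close> as she would in \<open>G + *k\<close> with \<open>k\<close> so
  large that \<open>*k\<close> equals no follower of \<open>G\<close>.  Heaps are affine impartial, so each of them is a nimber or
  the moon, and the moon absorbs sums; this gives the immediate nimbers.  The only check among the
  Left options of a heap is the entailing move, after which Right must move in the remaining heap.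
  That move protects \<open>*k\<close> unless an option \<open>g\<close> of the remaining heap lets its mover win \<open>g + *k\<close>
  moving second, and this means that \<open>*k\<close> is an immediate or protected nimber of the remaining
  heap.\<close>

section \<open>Sums, negation and winning strategies\<close>

abbreviation "LF \<equiv> left_wins_first"
abbreviation "LS \<equiv> left_wins_second"

lemma size_left_opts: "g |\<in>| left_opts G \<Longrightarrow> size g < size G"
  by (cases G) (auto simp: size_option)
lemma size_right_opts: "g |\<in>| right_opts G \<Longrightarrow> size g < size G"
  by (cases G) (auto simp: size_option)

lemma game_opts_induct:
  assumes "\<And>G. (\<And>g. g |\<in>| left_opts G \<Longrightarrow> P g) \<Longrightarrow> (\<And>g. g |\<in>| right_opts G \<Longrightarrow> P g) \<Longrightarrow> P G"
  shows "P G"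
  by (induction G rule: measure_induct_rule[of size]) (metis assms size_left_opts size_right_opts)

lemma plus_LInf_right [simp]: "G + LInf = LInf" by (cases G) auto
lemma plus_game_commute: "G + H = H + (G::game)"
proof (induction G H rule: plus_game.induct)
  case (7 GL GR HL HR)
  then show ?case by (simp add: sup_commute cong: fset.map_cong)
qed (auto simp: sup_commute)

text \<open>The excluded pairs are those where the convention \<open>LInf + RInf = LInf\<close>
  breaks the symmetry between the players.\<close>

lemma neg_plus: "\<not> (G = LInf \<and> H = RInf) \<Longrightarrow> \<not> (G = RInf \<and> H = LInf) \<Longrightarrow> - (G + H) = - G + - (H::game)"
proof (induction G H rule: plus_game.induct)
  case (1 H)
  then show ?case by (cases H) auto
next
  case (7 GL GR HL HR)
  then show ?case by (simp add: sup_commute fimage_funion fset.map_comp comp_def cong: fset.map_cong)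
qed auto

lemma neg_neg [simp]: "- (- G) = (G::game)"
  by (induction G) (auto simp: fset.map_comp comp_def cong: fset.map_cong)

lemma wins_neg: "(LF (- G) \<longleftrightarrow> \<not> LS G) \<and> (LS (- G) \<longleftrightarrow> \<not> LF G)"
  by (induction G) (auto)

text \<open>Left opens in the summand that she wins moving first, then answers each move of Right in
  the summand where it was made. The three claims feed each other in the induction.\<close>

lemma wins_plus: "(LF G \<and> LS H \<longrightarrow> LF (G + H)) \<and> (LS G \<and> LF H \<longrightarrow> LF (G + H)) \<and>
  (LS G \<and> LS H \<longrightarrow> LS (G + H))"
proof (induction G H rule: plus_game.induct)
  case (7 GL GR HL HR)
  then show ?case by (fastforce)
qed auto

lemma plus_terminal: "G = LInf \<or> G = RInf \<Longrightarrow> H \<noteq> LInf \<Longrightarrow> G + H = G"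
  by (cases H) auto

lemma plus_not_terminal:
  "G \<noteq> LInf \<Longrightarrow> G \<noteq> RInf \<Longrightarrow> H \<noteq> LInf \<Longrightarrow> H \<noteq> RInf \<Longrightarrow> G + H \<noteq> LInf \<and> G + H \<noteq> RInf"
  by (cases G; cases H) auto

lemma opts_plus:
  assumes "G \<noteq> LInf" "G \<noteq> RInf" "H \<noteq> LInf" "H \<noteq> RInf"
  shows left_opts_plus: "left_opts (G + H) = (\<lambda>g. g + H) |`| left_opts G |\<union>| (\<lambda>h. G + h) |`| left_opts H"
    and right_opts_plus: "right_opts (G + H) = (\<lambda>g. g + H) |`| right_opts G |\<union>| (\<lambda>h. G + h) |`| right_opts H"
  using assms by (cases G; cases H; auto)+

lemma game_eqI:
  assumes "G \<noteq> LInf" "G \<noteq> RInf" "H \<noteq> LInf" "H \<noteq> RInf"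
    "left_opts G = left_opts H" "right_opts G = right_opts H"
  shows "G = H"
  using assms by (cases G; cases H) auto

text \<open>No side condition on terminal games appears, because \<open>LInf\<close> absorbs
  everything, \<open>RInf\<close> included. Otherwise the options agree by induction on the total
  size.\<close>

lemma plus_game_assoc: "(G + H) + K = G + (H + (K::game))"
proof (induction "size G + size H + size K" arbitrary: G H K rule: less_induct)
  case less
  show ?case
  proof (cases "G \<noteq> LInf \<and> G \<noteq> RInf \<and> H \<noteq> LInf \<and> H \<noteq> RInf \<and> K \<noteq> LInf \<and> K \<noteq> RInf")
    case True
    have [simp]: "g + H + K = g + (H + K)" if "g |\<in>| left_opts G \<or> g |\<in>| right_opts G" for g
      using less that size_left_opts[of g G] size_right_opts[of g G] by auto
    have [simp]: "G + h + K = G + (h + K)" if "h |\<in>| left_opts H \<or> h |\<in>| right_opts H" for h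
      using less that size_left_opts[of h H] size_right_opts[of h H] by auto
    have [simp]: "G + H + k = G + (H + k)" if "k |\<in>| left_opts K \<or> k |\<in>| right_opts K" for k
      using less that size_left_opts[of k K] size_right_opts[of k K] by auto
    show ?thesis using True
      by (intro game_eqI)
        (auto simp: plus_not_terminal opts_plus fimage_funion fset.map_comp comp_def sup_assoc
          cong: fset.map_cong)
  next
    case False
    then show ?thesis by (cases G; cases H; cases K) auto
  qed
qed

instance game :: ab_semigroup_add
  by standard (rule plus_game_assoc, rule plus_game_commute)

text \<open>The dual of \<open>wins_plus\<close> under negation. The hypotheses rule out
  \<open>LInf\<close> as a summand, so \<open>neg_plus\<close> applies.\<close>

lemma not_LF_plus: "\<not> LF G \<Longrightarrow> \<not> LF H \<Longrightarrow> \<not> LF (G + H)"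
  using wins_plus[of "- G" "- H"] neg_plus[of G H] wins_neg[of G] wins_neg[of H] wins_neg[of "G + H"]
  by (metis left_wins_first.simps(1))
lemma not_LS_plus: "\<not> LS G \<Longrightarrow> \<not> LF H \<Longrightarrow> \<not> LS (G + H)"
  using wins_plus[of "- G" "- H"] neg_plus[of G H] wins_neg[of G] wins_neg[of H] wins_neg[of "G + H"]
  by (metis left_wins_first.simps(1) left_wins_second.simps(1))

lemma outcome_P_iff: "outcome G = Out_P \<longleftrightarrow> \<not> LF G \<and> LS G"
  and outcome_N_iff: "outcome G = Out_N \<longleftrightarrow> LF G \<and> \<not> LS G"
  and outcome_L_iff: "outcome G = Out_L \<longleftrightarrow> LF G \<and> LS G"
  by (auto simp: outcome_def)
lemma outcome_eq_iff: "outcome G = outcome H \<longleftrightarrow> (LF G \<longleftrightarrow> LF H) \<and> (LS G \<longleftrightarrow> LS H)"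
  by (auto simp: outcome_def)

lemma outcome_plus_P: "outcome H = Out_P \<Longrightarrow> outcome (G + H) = outcome G"
  using wins_plus[of G H] not_LF_plus[of G H] not_LS_plus[of G H]
  by (auto simp: outcome_P_iff outcome_eq_iff)

section \<open>Symmetric games and checks\<close>

lemma symmetric_iff: "symmetric G \<longleftrightarrow> G \<noteq> LInf \<and> G \<noteq> RInf \<and> - G = G"
  unfolding symmetric_def by (cases G) (auto simp: fset.map_comp comp_def)

lemma symmetric_plus: "symmetric G \<Longrightarrow> symmetric H \<Longrightarrow> symmetric (G + H)"
  unfolding symmetric_iff using neg_plus[of G H] plus_not_terminal by metis

lemma symmetric_wins: "symmetric G \<Longrightarrow> LF G \<longleftrightarrow> \<not> LS G"
  unfolding symmetric_iff using wins_neg[of G] by metis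

lemma symmetric_outcome_P: "symmetric G \<Longrightarrow> outcome G = Out_P \<longleftrightarrow> LS G"
  using symmetric_wins outcome_P_iff by blast
lemma symmetric_outcome_N: "symmetric G \<Longrightarrow> outcome G = Out_N \<longleftrightarrow> LF G"
  using symmetric_wins outcome_N_iff by blast

lemma symmetric_right_opts: "symmetric G \<Longrightarrow> right_opts G = uminus |`| left_opts G"
  by (auto simp: symmetric_def)

lemma plus_eq_terminal_iff:
  assumes "H \<noteq> LInf" "H \<noteq> RInf"
  shows "G + H = LInf \<longleftrightarrow> G = LInf" "LInf = G + H \<longleftrightarrow> G = LInf"
    "G + H = RInf \<longleftrightarrow> G = RInf" "RInf = G + H \<longleftrightarrow> G = RInf"
    "H + G = LInf \<longleftrightarrow> G = LInf" "LInf = H + G \<longleftrightarrow> G = LInf"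
    "H + G = RInf \<longleftrightarrow> G = RInf" "RInf = H + G \<longleftrightarrow> G = RInf"
  using assms by (cases G; cases H; simp)+

lemma
  assumes "G \<noteq> LInf" "G \<noteq> RInf" "H \<noteq> LInf" "H \<noteq> RInf"
  shows left_check_plus: "left_check (G + H) \<longleftrightarrow> left_check G \<or> left_check H"
    and right_check_plus: "right_check (G + H) \<longleftrightarrow> right_check G \<or> right_check H"
  using assms
  by (auto simp: left_check_def right_check_def opts_plus image_iff plus_eq_terminal_iff)

lemma LF_plus_iff:
  assumes "G \<noteq> LInf" "G \<noteq> RInf" "H \<noteq> LInf" "H \<noteq> RInf"
  shows "LF (G + H) \<longleftrightarrow>
    (\<exists>g. g |\<in>| left_opts G \<and> LS (g + H)) \<or> (\<exists>h. h |\<in>| left_opts H \<and> LS (G + h))"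
  using assms by (cases G; cases H) auto

lemma LS_plus_iff:
  assumes "G \<noteq> LInf" "G \<noteq> RInf" "H \<noteq> LInf" "H \<noteq> RInf"
  shows "LS (G + H) \<longleftrightarrow>
    (\<forall>g. g |\<in>| right_opts G \<longrightarrow> LF (g + H)) \<and> (\<forall>h. h |\<in>| right_opts H \<longrightarrow> LF (G + h))"
  using assms by (cases G; cases H) auto

text \<open>Left moves to \<open>LInf\<close>, which absorbs the other summand; a summand
  \<open>RInf\<close> would have ended the game already.\<close>

lemma left_check_LF_plus: "left_check G \<Longrightarrow> H \<noteq> RInf \<Longrightarrow> LF (G + H)"
  by (cases G; cases H) (force simp: left_check_def)+

lemma right_check_not_LS_plus: "right_check G \<Longrightarrow> H \<noteq> LInf \<Longrightarrow> \<not> LS (G + H)"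
  by (cases G; cases H) (force simp: right_check_def)+

lemma symmetric_check: "symmetric G \<Longrightarrow> left_check G \<longleftrightarrow> right_check G"
  unfolding left_check_def right_check_def symmetric_right_opts
  by (metis fimage_eqI fimageE neg_neg uminus_game.simps(1))

section \<open>Affine impartial games and their sums\<close>

definition impartial_followers :: "game \<Rightarrow> bool" where
  "impartial_followers G \<longleftrightarrow> (\<forall>H. follower G H \<and> quiet H \<longrightarrow> symmetric H)"

lemma affine_impartial_iff: "affine_impartial G \<longleftrightarrow> symmetric G \<and> impartial_followers G"
  by (simp add: affine_impartial_def impartial_followers_def)

lemma follower_option:
  assumes "follower K H" "K |\<in>| left_opts G \<or> K |\<in>| right_opts G"
  shows "follower G H"
  using assms by (induction) (meson follower.intros)+

lemma follower_cases:
  assumes "follower G H"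
  shows "H = G \<or> (\<exists>K. (K |\<in>| left_opts G \<or> K |\<in>| right_opts G) \<and> follower K H)"
  using assms by (induction) (meson follower.intros)+

text \<open>Unlike \<open>affine_impartial\<close>, this property passes to every option, checks
  included, as inductions over followers require.\<close>

lemma impartial_followers_iff:
  "impartial_followers G \<longleftrightarrow> (quiet G \<longrightarrow> symmetric G) \<and>
    (\<forall>K. K |\<in>| left_opts G \<or> K |\<in>| right_opts G \<longrightarrow> impartial_followers K)"
  unfolding impartial_followers_def
  using follower_option follower_cases follower.refl by metis

lemma quiet_plus:
  assumes "quiet (G + H)"
  shows "quiet G" "quiet H"
proof -
  have "G + H \<noteq> LInf" "G + H \<noteq> RInf" using assms by (auto simp: quiet_def)
  then have "G \<noteq> LInf" "G \<noteq> RInf" "H \<noteq> LInf" "H \<noteq> RInf" by (cases G; cases H; auto)+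
  then show "quiet G" "quiet H" using assms by (auto simp: quiet_def left_check_plus right_check_plus)
qed

lemma impartial_followers_terminal [simp]: "impartial_followers LInf" "impartial_followers RInf"
  by (subst impartial_followers_iff; simp add: quiet_def)+

text \<open>A quiet sum has quiet summands; these are symmetric, hence so is the sum.\<close>

lemma impartial_followers_plus:
  "impartial_followers G \<Longrightarrow> impartial_followers H \<Longrightarrow> impartial_followers (G + H)"
proof (induction G H rule: plus_game.induct)
  case (7 GL GR HL HR)
  have o: "impartial_followers K" if "K |\<in>| GL |\<union>| GR |\<union>| HL |\<union>| HR" for K
    using that 7(5,6) impartial_followers_iff[of "Game GL GR"] impartial_followers_iff[of "Game HL HR"]
    by auto
  have "symmetric (Game GL GR + Game HL HR)" if "quiet (Game GL GR + Game HL HR)"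
    using that quiet_plus 7(5,6) symmetric_plus impartial_followers_iff by blast
  moreover have "impartial_followers K"
    if "K |\<in>| left_opts (Game GL GR + Game HL HR) \<or> K |\<in>| right_opts (Game GL GR + Game HL HR)" for K
    using that 7 o by auto
  ultimately show ?case using impartial_followers_iff by blast
qed auto

lemma affine_impartial_plus: "affine_impartial G \<Longrightarrow> affine_impartial H \<Longrightarrow> affine_impartial (G + H)"
  by (simp add: affine_impartial_iff symmetric_plus impartial_followers_plus)

section \<open>Nimbers\<close>

lemma nimber_opts [simp]:
  "left_opts (nimber n) = nimber |`| fset_of_list [0..<n]"
  "right_opts (nimber n) = nimber |`| fset_of_list [0..<n]"
  by (subst nimber.simps; simp)+

lemma nimber_not_terminal [simp]: "nimber n \<noteq> LInf" "nimber n \<noteq> RInf" "LInf \<noteq> nimber n" "RInf \<noteq> nimber n"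
  by (subst nimber.simps; simp)+

lemma neg_nimber [simp]: "- nimber n = nimber n"
proof (induction n rule: less_induct)
  case (less n)
  have "uminus |`| nimber |`| fset_of_list [0..<n] = nimber |`| fset_of_list [0..<n]"
    using less by (auto simp: fset.map_comp fset_of_list.rep_eq intro!: fset.map_cong)
  moreover have "nimber n = Game (nimber |`| fset_of_list [0..<n]) (nimber |`| fset_of_list [0..<n])"
    by (subst nimber.simps) simp
  ultimately show ?case by simp
qed

lemma symmetric_nimber [simp]: "symmetric (nimber n)"
  by (simp add: symmetric_iff)

lemma affine_impartial_nimber [simp]: "affine_impartial (nimber n)"
proof -
  have "impartial_followers (nimber n)"
  proof (induction n rule: less_induct)
    case (less n)
    then show ?case by (subst impartial_followers_iff) (auto simp: fset_of_list.rep_eq)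
  qed
  then show ?thesis by (simp add: affine_impartial_iff)
qed

lemma outcome_nimber_plus_self: "outcome (nimber n + nimber n) = Out_P"
proof -
  have "LS (nimber n + nimber n)"
  proof (induction n rule: less_induct)
    case (less n)
    \<comment> \<open>The copying reply leads to \<open>nimber j + nimber j\<close>, which Left wins
      moving second by induction.\<close>
    have "LF (nimber j + nimber n)" "LF (nimber n + nimber j)" if "j < n" for j
      using that less[OF that] by (auto simp: LF_plus_iff fset_of_list.rep_eq)
    then show ?case
      by (auto simp: LS_plus_iff fset_of_list.rep_eq)
  qed
  then show ?thesis by (simp add: symmetric_outcome_P symmetric_plus)
qed

lemma outcome_nimber_plus_nimber: "outcome (nimber i + nimber j) = Out_P \<longleftrightarrow> i = j"
proof -
  have "LF (nimber i + nimber j)" "LF (nimber j + nimber i)" if "i < j" for i j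
    using that outcome_nimber_plus_self[of i]
    by (auto simp: LF_plus_iff fset_of_list.rep_eq outcome_P_iff)
  then show ?thesis
    using outcome_nimber_plus_self[of i]
    by (cases i j rule: linorder_cases) (auto simp: outcome_P_iff)
qed

text \<open>Adding \<open>nimber k + nimber k\<close> keeps the outcome. After regrouping, one copy
  joins \<open>G\<close> to form a second-player win, which is dropped, and the other stays with
  \<open>X\<close>.\<close>

lemma outcome_plus_nimber_cong:
  assumes "outcome (G + nimber k) = Out_P"
  shows "outcome (G + X) = outcome (nimber k + X)"
proof -
  have "outcome (G + X) = outcome ((G + X) + (nimber k + nimber k))"
    by (simp add: outcome_plus_P outcome_nimber_plus_self)
  also have "(G + X) + (nimber k + nimber k) = (nimber k + X) + (G + nimber k)"
    by (simp add: ac_simps)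
  also have "outcome \<dots> = outcome (nimber k + X)"
    by (rule outcome_plus_P[OF assms])
  finally show ?thesis .
qed

lemma eq_nimber_iff: "G \<approx> nimber k \<longleftrightarrow> outcome (G + nimber k) = Out_P"
  unfolding eq_im_def using outcome_plus_nimber_cong outcome_nimber_plus_self affine_impartial_nimber
  by metis

section \<open>Uniqueness of nimber values, and the moon as the only alternative\<close>

lemma outcome_plus_nimber_unique:
  "outcome (G + nimber i) = Out_P \<Longrightarrow> outcome (G + nimber j) = Out_P \<Longrightarrow> i = j"
  using outcome_plus_nimber_cong outcome_nimber_plus_nimber by metis

text \<open>At most one \<open>k\<close> fails. The filter form lets finitely many such demands, one
  for each option, be met by a single \<open>k\<close>.\<close>

lemma eventually_outcome_plus_nimber:
  "eventually (\<lambda>k. outcome (G + nimber k) \<noteq> Out_P) sequentially"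
proof (cases "\<exists>j. outcome (G + nimber j) = Out_P")
  case True
  then obtain j where j: "outcome (G + nimber j) = Out_P" by blast
  show ?thesis
  proof (rule eventually_sequentiallyI[of "Suc j"])
    fix k assume "Suc j \<le> k"
    then have "j \<noteq> k" by simp
    then show "outcome (G + nimber k) \<noteq> Out_P" using outcome_plus_nimber_unique[OF j] by blast
  qed
qed simp

text \<open>Left transfers her strategy on \<open>H + *k\<close> to \<open>H + X\<close>.  When a quiet follower of \<open>H\<close> is reached it
  is not \<open>*k\<close>, so it is either some other nimber \<open>*j\<close>, and Left wins because she wins \<open>X + *j\<close>
  moving first, or it equals no nimber and her winning move in its sum with \<open>*k\<close> is not on \<open>*k\<close>.\<close>

lemma eventually_wins_plus_loony:
  assumes X: "symmetric X" "\<not> left_check X" "\<not> right_check X" and XN: "\<And>j. LF (X + nimber j)"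
  shows "impartial_followers H \<Longrightarrow>
     \<forall>\<^sub>F k in sequentially. (LS (H + nimber k) \<longrightarrow> LS (H + X)) \<and> (LF (H + nimber k) \<longrightarrow> LF (H + X))"
proof (induction H rule: game_opts_induct)
  case (1 H)
  let ?Q = "\<lambda>H k. (LS (H + nimber k) \<longrightarrow> LS (H + X)) \<and> (LF (H + nimber k) \<longrightarrow> LF (H + X))"
  note nt = X(1)[unfolded symmetric_iff]
  have "impartial_followers g" if "g |\<in>| left_opts H \<or> g |\<in>| right_opts H" for g
    using that 1(3) impartial_followers_iff by blast
  \<comment> \<open>The option sets are finite, so one threshold for \<open>k\<close> serves all
    options at once.\<close>
  then have "\<forall>\<^sub>F k in sequentially. \<forall>g\<in>fset (left_opts H) \<union> fset (right_opts H). ?Q g k"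
    using 1(1,2) by (intro eventually_ball_finite) auto
  moreover have "\<forall>\<^sub>F k in sequentially. outcome (H + nimber k) \<noteq> Out_P"
    by (rule eventually_outcome_plus_nimber)
  ultimately show ?case
  proof eventually_elim
    case (elim k)
    have H: "H + nimber k = H" "H + X = H" if "H = LInf \<or> H = RInf"
      using that nt plus_terminal by auto
    \<comment> \<open>No move in \<open>nimber k\<close> wins here, so Left's winning move lies in
      \<open>H\<close>, and the induction hypothesis carries it over to
      \<open>H + X\<close>.\<close>
    have left: "LF (H + X)"
      if "H \<noteq> LInf" "H \<noteq> RInf" "\<And>i. i < k \<Longrightarrow> \<not> LS (H + nimber i)" "LF (H + nimber k)"
      using that elim(1) by (auto simp: LF_plus_iff nt fset_of_list.rep_eq)
    consider "H = LInf \<or> H = RInf" | "right_check H" "left_check H" | "right_check H" "\<not> left_check H"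
      | "left_check H" "\<not> right_check H" | "quiet H"
      by (auto simp: quiet_def)
    then show ?case
    proof cases
      case 1
      then show ?thesis using H by auto
    next
      case 2
      then show ?thesis using left_check_LF_plus right_check_not_LS_plus nt by auto
    next
      case 3
      moreover from 3 have "H \<noteq> LInf" "H \<noteq> RInf" by (auto simp: right_check_def)
      ultimately show ?thesis using left right_check_not_LS_plus by auto
    next
      case 4
      then have "H \<noteq> LInf" "H \<noteq> RInf" by (auto simp: left_check_def)
      \<comment> \<open>If Right ignores the threat and moves in \<open>X\<close>, where he has no
        check, Left takes \<open>LInf\<close> in \<open>H\<close>. His moves in \<open>H\<close>
        fall under the induction hypothesis.\<close>
      moreover have "LF (H + x)" if "x |\<in>| right_opts X" for x
        using that 4 X(3) by (intro left_check_LF_plus) (auto simp: right_check_def)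
      ultimately have "LS (H + X)" if "LS (H + nimber k)"
        using that elim(1) by (auto simp: LS_plus_iff nt)
      with 4 show ?thesis using left_check_LF_plus nt by auto
    next
      case 5
      then have s: "symmetric H" and t: "H \<noteq> LInf" "H \<noteq> RInf"
        using 1(3) impartial_followers_iff[of H] by (auto simp: quiet_def)
      have "LF (H + X)" if "LF (H + nimber k)"
      proof (cases "\<exists>j. outcome (H + nimber j) = Out_P")
        case True
        then show ?thesis
          using outcome_plus_nimber_cong XN by (metis outcome_eq_iff add.commute)
      next
        case False
        then show ?thesis
          using that left t symmetric_outcome_P[OF symmetric_plus[OF s]] by simp
      qed
      then show ?thesis using elim(2) symmetric_outcome_P[OF symmetric_plus[OF s]] by simp
    qed
  qed
qed

lemma outcome_moon_plus: "symmetric X \<Longrightarrow> outcome (moon + X) = Out_N"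
  using left_check_LF_plus[of moon X] right_check_not_LS_plus[of moon X]
  by (simp add: outcome_N_iff symmetric_iff left_check_def right_check_def moon_def)

lemma eq_moon_iff: "G \<approx> moon \<longleftrightarrow> (\<forall>X. affine_impartial X \<longrightarrow> outcome (G + X) = Out_N)"
  unfolding eq_im_def using outcome_moon_plus affine_impartial_iff by simp

text \<open>When \<open>G\<close> equals no nimber, the first player must win \<open>G + X\<close>
  for every \<open>X\<close>. The three cases are \<open>X\<close> with a check, \<open>X\<close>
  quiet and equal to a nimber, and \<open>X\<close> quiet and equal to none.\<close>

lemma affine_impartial_nimber_or_moon:
  assumes "affine_impartial G"
  shows "(\<exists>k. G \<approx> nimber k) \<or> G \<approx> moon"
proof (cases "\<exists>k. outcome (G + nimber k) = Out_P")
  case True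
  then show ?thesis using eq_nimber_iff by blast
next
  case False
  have G: "symmetric G" "impartial_followers G" using assms affine_impartial_iff by auto
  have GN: "LF (G + nimber k)" for k
    using False symmetric_plus[OF G(1) symmetric_nimber] symmetric_wins symmetric_outcome_P by blast
  have "outcome (G + X) = Out_N" if X: "affine_impartial X" for X
  proof -
    have sX: "symmetric X" using X affine_impartial_iff by auto
    have "LF (G + X)"
    proof (cases "quiet X")
      case False
      \<comment> \<open>A symmetric form with a check for one player has one for the other, and Left
        ends the game with hers.\<close>
      then have "left_check X"
        using sX symmetric_check[of X] by (auto simp: quiet_def symmetric_iff)
      then show ?thesis
        using left_check_LF_plus[of X G] G(1) by (simp add: add.commute symmetric_iff)
    next
      case q: True
      show ?thesis
      proof (cases "\<exists>j. outcome (X + nimber j) = Out_P")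
        case True
        then show ?thesis using outcome_plus_nimber_cong GN by (metis outcome_eq_iff add.commute)
      next
        case False
        then have "LF (X + nimber j)" for j
          using symmetric_plus[OF sX symmetric_nimber] symmetric_wins symmetric_outcome_P by blast
        \<comment> \<open>The transfer holds for large \<open>k\<close> only, but \<open>GN\<close>
          supplies a win for every \<open>k\<close>.\<close>
        then obtain k where "LF (G + nimber k) \<longrightarrow> LF (G + X)"
          using eventually_wins_plus_loony[OF sX _ _ _ G(2)] q
          unfolding eventually_sequentially quiet_def by blast
        then show ?thesis using GN by blast
      qed
    qed
    then show ?thesis using G(1) sX symmetric_outcome_N symmetric_plus by blast
  qed
  then show ?thesis using eq_moon_iff by blast
qed

section \<open>Values of sums and Grundy values\<close>

lemma nimber_not_eq_moon: "\<not> nimber k \<approx> moon"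
proof
  assume "nimber k \<approx> moon"
  then have "outcome (nimber k + nimber k) = Out_N" using eq_moon_iff affine_impartial_nimber by blast
  then show False by (simp add: outcome_nimber_plus_self)
qed

text \<open>Suppose no nimber works, and choose \<open>k\<close> so that no option of the sum equals
  \<open>nimber k\<close>. Then neither a move in the sum nor a move in \<open>nimber k\<close>
  wins, so the second player wins after all.\<close>

lemma nimber_plus_nimber: "\<exists>c. nimber a + nimber b \<approx> nimber c"
proof (rule ccontr)
  let ?G = "nimber a + nimber b"
  assume "\<not> ?thesis"
  then have N: "\<not> LS (?G + nimber c)" for c
    using eq_nimber_iff symmetric_outcome_P symmetric_plus symmetric_nimber by blast
  have "\<forall>\<^sub>F k in sequentially. \<forall>g\<in>fset (left_opts ?G). outcome (g + nimber k) \<noteq> Out_P"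
    by (intro eventually_ball_finite ballI eventually_outcome_plus_nimber) simp
  then obtain k where k: "\<And>g. g |\<in>| left_opts ?G \<Longrightarrow> outcome (g + nimber k) \<noteq> Out_P"
    unfolding eventually_sequentially by blast
  have "symmetric g" if "g |\<in>| left_opts ?G" for g
    using that by (auto simp: opts_plus symmetric_plus)
  then have "\<not> LS (g + nimber k)" if "g |\<in>| left_opts ?G" for g
    using that k symmetric_outcome_P symmetric_plus symmetric_nimber by blast
  then have "\<not> LF (?G + nimber k)"
    using N by (subst LF_plus_iff) (auto simp: plus_not_terminal)
  then show False using N symmetric_wins[of "?G + nimber k"] by (simp add: symmetric_plus)
qed

lemma eq_im_refl: "G \<approx> G" and eq_im_sym: "G \<approx> H \<Longrightarrow> H \<approx> G"
  and eq_im_trans: "G \<approx> H \<Longrightarrow> H \<approx> K \<Longrightarrow> G \<approx> K"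
  by (auto simp: eq_im_def)

lemma eq_im_plus_right:
  assumes "G \<approx> H" "affine_impartial K"
  shows "G + K \<approx> H + K"
  using assms affine_impartial_plus unfolding eq_im_def by (simp add: add.assoc)

text \<open>This gives the uniqueness behind the definite description in
  \<open>grundy\<close>.\<close>

lemma value_game_inject: "value_game v \<approx> value_game w \<longleftrightarrow> v = w"
proof -
  have "i = j" if "nimber i \<approx> nimber j" for i j
    using that eq_nimber_iff outcome_nimber_plus_nimber by blast
  moreover have "\<not> moon \<approx> nimber j" for j
    using nimber_not_eq_moon eq_im_sym by blast
  ultimately show ?thesis
    using nimber_not_eq_moon eq_im_refl by (cases v; cases w) auto
qed

lemma grundy_eqI: "G \<approx> value_game v \<Longrightarrow> grundy G = v"
  unfolding grundy_def using value_game_inject eq_im_sym eq_im_trans by (blast intro: the_equality)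

lemma nimber_inject: "nimber i = nimber j \<longleftrightarrow> i = j"
  using outcome_nimber_plus_nimber outcome_nimber_plus_self by metis

lemma neg_fimage_symmetric: "(\<And>g. g |\<in>| A \<Longrightarrow> - g = g) \<Longrightarrow> uminus |`| A = (A :: game fset)"
  by (simp cong: fset.map_cong)

text \<open>For an affine impartial \<open>X\<close>, the game \<open>H + X\<close> is again one
  against which \<open>G\<close> can be tested.\<close>

lemma eq_moon_plus:
  assumes "G \<approx> moon" "affine_impartial H"
  shows "G + H \<approx> moon"
  using assms affine_impartial_plus unfolding eq_moon_iff by (simp add: add.assoc)

text \<open>The moon absorbs sums, and two summands other than the moon are nimbers. This produces
  the side condition on the two parts of a split.\<close>

lemma plus_eq_nimber_iff:
  assumes G: "affine_impartial G" and H: "affine_impartial H"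
  shows "(\<exists>k. G + H \<approx> nimber k) \<longleftrightarrow> \<not> G \<approx> moon \<and> \<not> H \<approx> moon"
proof
  assume "\<exists>k. G + H \<approx> nimber k"
  then have "\<not> G + H \<approx> moon"
    using nimber_not_eq_moon eq_im_sym eq_im_trans by blast
  then show "\<not> G \<approx> moon \<and> \<not> H \<approx> moon"
    using eq_moon_plus[OF _ H] eq_moon_plus[OF _ G] add.commute[of H G] by metis
next
  assume "\<not> G \<approx> moon \<and> \<not> H \<approx> moon"
  then obtain a b where ab: "G \<approx> nimber a" "H \<approx> nimber b"
    using affine_impartial_nimber_or_moon[OF G] affine_impartial_nimber_or_moon[OF H] by blast
  obtain c where c: "nimber a + nimber b \<approx> nimber c" using nimber_plus_nimber by blast
  have "G + H \<approx> nimber a + H" by (rule eq_im_plus_right[OF ab(1) H])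
  moreover have "nimber a + H \<approx> nimber a + nimber b"
    using eq_im_plus_right[OF ab(2), of "nimber a"] by (simp add: add.commute)
  ultimately show "\<exists>k. G + H \<approx> nimber k" using c eq_im_trans by blast
qed

section \<open>Heaps of top entails\<close>

definition entail :: "nat \<Rightarrow> game" where
  "entail n = Game {|LInf|} (right_opts (heap n))"

lemma heap_Suc_left_opts:
  "g |\<in>| left_opts (heap (Suc n)) \<longleftrightarrow>
    g = entail n \<or> (\<exists>l m. l + m = Suc n \<and> 0 < l \<and> 0 < m \<and> g = heap l + heap m)"
proof -
  have "(\<exists>l\<in>{1..<Suc n}. g = heap l + heap (Suc n - l)) \<longleftrightarrow>
      (\<exists>l m. l + m = Suc n \<and> 0 < l \<and> 0 < m \<and> g = heap l + heap m)"
  proof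
    assume "\<exists>l\<in>{1..<Suc n}. g = heap l + heap (Suc n - l)"
    then obtain l where "1 \<le> l" "l < Suc n" "g = heap l + heap (Suc n - l)" by auto
    then show "\<exists>l m. l + m = Suc n \<and> 0 < l \<and> 0 < m \<and> g = heap l + heap m"
      by (intro exI[of _ l] exI[of _ "Suc n - l"]) auto
  next
    assume "\<exists>l m. l + m = Suc n \<and> 0 < l \<and> 0 < m \<and> g = heap l + heap m"
    then obtain l m where "l + m = Suc n" "0 < l" "0 < m" "g = heap l + heap m" by blast
    then show "\<exists>l\<in>{1..<Suc n}. g = heap l + heap (Suc n - l)"
      by (intro bexI[of _ l]) (auto simp flip: \<open>l + m = Suc n\<close> simp del: heap.simps)
  qed
  then show ?thesis
    by (auto simp: entail_def fset_of_list.rep_eq)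
qed

text \<open>Splits are sums of smaller heaps. The entailing options are checks, hence not quiet and
  exempt from symmetry; only their own options have to be examined.\<close>

lemma affine_impartial_heap: "affine_impartial (heap n)"
proof (induction n rule: less_induct)
  case (less n)
  show ?case
  proof (cases n)
    case 0
    then show ?thesis
      by (simp add: affine_impartial_iff symmetric_iff zero_game_def impartial_followers_iff[of "Game {||} {||}"])
  next
    case (Suc m)
    let ?S = "fset_of_list (map (\<lambda>l. heap l + heap (Suc m - l)) [1..<Suc m])"
    have h: "heap n = Game (finsert (entail m) ?S) (finsert (Game (left_opts (heap m)) {|RInf|}) ?S)"
      by (simp add: Suc entail_def)
    have AS: "affine_impartial g" if "g |\<in>| ?S" for g
      using that less Suc by (auto simp: fset_of_list.rep_eq simp del: heap.simps intro!: affine_impartial_plus)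
    have Am: "affine_impartial (heap m)" using less Suc by auto
    have negS: "uminus |`| ?S = ?S"
      using AS by (intro neg_fimage_symmetric) (auto simp: affine_impartial_iff symmetric_iff)
    \<comment> \<open>Negation swaps the option sets of the symmetric \<open>heap m\<close>, so the
      two entailing options of \<open>heap n\<close> are negatives of each other.\<close>
    have "uminus |`| right_opts (heap m) = left_opts (heap m)"
      using Am symmetric_right_opts
      by (simp add: affine_impartial_iff fset.map_comp comp_def)
    then have negE: "- entail m = Game (left_opts (heap m)) {|RInf|}"
      by (simp add: entail_def)
    have "symmetric (heap n)"
      unfolding symmetric_def h
      by (rule exI[of _ "finsert (entail m) ?S"]) (simp only: fimage_finsert negS negE)
    moreover have "impartial_followers K"
      if K: "K |\<in>| left_opts (heap n) \<or> K |\<in>| right_opts (heap n)" for K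
    proof -
      have o: "impartial_followers K" if "K |\<in>| left_opts (heap m) \<or> K |\<in>| right_opts (heap m)" for K
        using that Am impartial_followers_iff[of "heap m"] affine_impartial_iff by blast
      consider "K |\<in>| ?S" | "K = entail m" | "K = Game (left_opts (heap m)) {|RInf|}"
        using K unfolding h left_opts.simps right_opts.simps finsert_iff by blast
      then show ?thesis
      proof cases
        case 1
        then show ?thesis using AS affine_impartial_iff by blast
      next
        case 2
        then show ?thesis
          using o by (subst impartial_followers_iff) (auto simp: entail_def quiet_def left_check_def)
      next
        case 3
        then show ?thesis
          using o by (subst impartial_followers_iff) (auto simp: quiet_def right_check_def)
      qed
    qed
    ultimately show ?thesis
      unfolding affine_impartial_iff impartial_followers_iff[of "heap n"] by blast
  qed
qed

lemma symmetric_heap: "symmetric (heap n)"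
  using affine_impartial_heap affine_impartial_iff by blast

section \<open>Immediate and protected nimbers of heaps\<close>

lemma left_check_entail: "left_check (entail n)"
  by (simp add: left_check_def entail_def)

lemma entail_not_eq_nimber: "\<not> entail n \<approx> nimber k"
  unfolding eq_nimber_iff outcome_P_iff using left_check_LF_plus[OF left_check_entail] by simp

text \<open>Hence the first branch of \<open>protected_nimbers\<close> never applies to a
  heap.\<close>

lemma heap_not_left_check: "\<not> left_check (heap n)"
proof -
  have "LInf \<noteq> entail m" "LInf \<noteq> heap l + heap m" for l m
    using plus_not_terminal[of "heap l" "heap m"] symmetric_heap
    by (auto simp: entail_def symmetric_iff simp del: heap.simps)
  then show ?thesis
    by (cases n) (auto simp: left_check_def heap_Suc_left_opts zero_game_def simp del: heap.simps(2))
qed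

text \<open>A split is symmetric, so winning as second player means outcome \<open>Out_P\<close>,
  that is, equality with \<open>nimber k\<close>. The entailing option is a check, so Left also wins
  moving first and the outcome is \<open>Out_L\<close>.\<close>

lemma left_opt_heap_LS_iff:
  assumes "g |\<in>| left_opts (heap n)"
  shows "LS (g + nimber k) \<longleftrightarrow> g \<approx> nimber k \<or> left_check g \<and> outcome (g + nimber k) = Out_L"
proof
  assume LS: "LS (g + nimber k)"
  obtain m where "n = Suc m" using assms by (cases n) (auto simp: zero_game_def)
  with assms consider "g = entail m" | l m where "g = heap l + heap m"
    by (auto simp: heap_Suc_left_opts simp del: heap.simps(2))
  then show "g \<approx> nimber k \<or> left_check g \<and> outcome (g + nimber k) = Out_L"
  proof cases
    case 1
    then show ?thesis using LS left_check_entail left_check_LF_plus by (simp add: outcome_L_iff)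
  next
    case 2
    then show ?thesis
      using LS eq_nimber_iff symmetric_outcome_P symmetric_plus symmetric_heap symmetric_nimber by metis
  qed
qed (auto simp: eq_nimber_iff outcome_P_iff outcome_L_iff)

lemma immediate_or_protected_heap_iff:
  "nimber k \<in> immediate_nimbers (heap n) \<union> protected_nimbers (heap n) \<longleftrightarrow>
    (\<exists>g. g |\<in>| left_opts (heap n) \<and> LS (g + nimber k))"
  using left_opt_heap_LS_iff[of _ n k] heap_not_left_check[of n]
  unfolding immediate_nimbers_def protected_nimbers_def left_check_def[of "heap n"]
  by (auto simp: nimber_inject)

text \<open>Splits are not checks, so \<open>entail n\<close> is the only option that can protect.
  As a check it lets Left win moving first, which leaves only the condition on moving
  second.\<close>

lemma protected_heap_Suc_iff:
  "nimber k \<in> protected_nimbers (heap (Suc n)) \<longleftrightarrow> LS (entail n + nimber k)"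
proof -
  have "\<not> left_check (heap l + heap m)" for l m
    using symmetric_heap heap_not_left_check left_check_plus symmetric_iff by metis
  then have "{g. g |\<in>| left_opts (heap (Suc n)) \<and> left_check g} = {entail n}"
    using left_check_entail unfolding heap_Suc_left_opts by blast
  moreover have "protected_nimbers (heap (Suc n)) = {nimber k | k.
      \<exists>g \<in> {g. g |\<in>| left_opts (heap (Suc n)) \<and> left_check g}. outcome (g + nimber k) = Out_L}"
    using heap_not_left_check[of "Suc n"]
    unfolding protected_nimbers_def left_check_def[of "heap (Suc n)"] by auto
  ultimately have "nimber k \<in> protected_nimbers (heap (Suc n)) \<longleftrightarrow> outcome (entail n + nimber k) = Out_L"
    by (auto simp: nimber_inject)
  then show ?thesis
    using left_check_LF_plus[OF left_check_entail] by (simp add: outcome_L_iff)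
qed

text \<open>In \<open>entail n + nimber k\<close> a move of Right in the nimber loses to
  \<open>LInf\<close>. He must move to \<open>- g\<close> for a Left option \<open>g\<close> of
  \<open>heap n\<close>, and this saves him exactly when Left, moving second, wins
  \<open>g + nimber k\<close>.\<close>

lemma protected_heap_Suc:
  "protected_nimbers (heap (Suc n)) =
    nimbers - (immediate_nimbers (heap n) \<union> protected_nimbers (heap n))"
proof -
  \<comment> \<open>Each nimber is its own negative, so exchanging the players affects only
    \<open>g\<close>.\<close>
  have "LF (- g + nimber k) \<longleftrightarrow> \<not> LS (g + nimber k)" for g k
    using wins_neg[of "g + nimber k"] neg_plus[of g "nimber k"] by simp
  then have "LS (entail n + nimber k) \<longleftrightarrow> (\<forall>g. g |\<in>| left_opts (heap n) \<longrightarrow> \<not> LS (g + nimber k))" for k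
    using left_check_LF_plus[OF left_check_entail, of _ n] symmetric_right_opts[OF symmetric_heap]
    by (subst LS_plus_iff) (auto simp: entail_def[of n] left_check_LF_plus left_check_def)
  then have "nimber k \<in> protected_nimbers (heap (Suc n)) \<longleftrightarrow>
      nimber k \<notin> immediate_nimbers (heap n) \<union> protected_nimbers (heap n)" for k
    unfolding protected_heap_Suc_iff immediate_or_protected_heap_iff by blast
  moreover have "protected_nimbers G \<subseteq> nimbers" for G
    by (auto simp: protected_nimbers_def nimbers_def)
  ultimately show ?thesis unfolding nimbers_def by blast
qed

text \<open>The entailing option equals no nimber, so only splits contribute, and a split has a
  nimber value exactly when neither part is the moon.\<close>

lemma immediate_heap_Suc:
  "immediate_nimbers (heap (Suc n)) =
    {value_game (grundy (heap l + heap m)) | l m.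
      l + m = Suc n \<and> 0 < l \<and> 0 < m \<and> \<not> heap l \<approx> moon \<and> \<not> heap m \<approx> moon}" (is "_ = ?R")
proof -
  have val: "value_game (grundy G) = nimber k" if "G \<approx> nimber k" for G k
    using that grundy_eqI[of G "enat k"] by simp
  note iff = plus_eq_nimber_iff[OF affine_impartial_heap affine_impartial_heap]
  have "immediate_nimbers (heap (Suc n)) = {nimber k | k l m.
      l + m = Suc n \<and> 0 < l \<and> 0 < m \<and> heap l + heap m \<approx> nimber k}"
    unfolding immediate_nimbers_def heap_Suc_left_opts using entail_not_eq_nimber by blast
  also have "\<dots> = ?R"
    unfolding iff[symmetric] using val by (auto; metis)
  finally show ?thesis .
qed

theorem theorem5p1:
  shows "protected_nimbers (heap 0) = {} \<and> immediate_nimbers (heap 0) = {} \<and>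
    (\<forall>n>0.
       protected_nimbers (heap n) =
         nimbers - (immediate_nimbers (heap (n - 1)) \<union> protected_nimbers (heap (n - 1))) \<and>
       immediate_nimbers (heap n) =
         {value_game (grundy (heap l + heap m)) | l m.
            l + m = n \<and> 0 < l \<and> 0 < m \<and> \<not> heap l \<approx> moon \<and> \<not> heap m \<approx> moon})"
proof (intro conjI allI impI)
  show "protected_nimbers (heap 0) = {}" "immediate_nimbers (heap 0) = {}"
    by (simp_all add: protected_nimbers_def immediate_nimbers_def zero_game_def)
next
  fix n :: nat
  assume "0 < n"
  then obtain m where n: "n = Suc m" by (cases n) auto
  show "protected_nimbers (heap n) =
      nimbers - (immediate_nimbers (heap (n - 1)) \<union> protected_nimbers (heap (n - 1)))"
    unfolding n diff_Suc_1 by (rule protected_heap_Suc)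
  show "immediate_nimbers (heap n) = {value_game (grundy (heap l + heap m)) | l m.
      l + m = n \<and> 0 < l \<and> 0 < m \<and> \<not> heap l \<approx> moon \<and> \<not> heap m \<approx> moon}"
    unfolding n by (rule immediate_heap_Suc)
qed

end
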